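(* Let $q\ge1$ be an integer, and let $A_i$, $i\ge-1$, be nonnegative $m\times m$ matrices with $\sum_{i=-1}^\infty A_i$ stochastic. Among all families of nonnegative $m\times m$ matrices $\{A_{\ell,i}\}_{-1\le \ell\le q,\ i\ge 0}$ satisfying $$A_\nu=A_{-1,\nu+1}+A_{0,\nu}+\cdots+A_{\nu,0}\quad(-1\le\nu\le q),\qquad A_\nu=A_{-1,\nu+1}+A_{0,\nu}+\cdots+A_{q,\nu-q}\quad(\nu\ge q+1),$$ the entrywise maximum of the matrix $$F=\sum_{\ell=0}^qA_\ell(G)\sum_{j=0}^\ell G^j$$ is attained by the choice $$A_{\ell,0}=A_\ell\ \ (-1\le\ell\le q),\qquad A_{q,\ell-q}=A_\ell\ \ (\ell\ge q+1),\qquad A_{\ell,i}=0\ \ (-1\le\ell\le q-1,\ i\ge1).$$ In other words, it is attained by $$A_\ell(z)=A_\ell\ \ (-1\le\ell\le q-1),\qquad A_q(z)=\sum_{i=q}^\infty A_iz^{i-q}.$$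
   Context: Inequalities between matrices are entrywise. $G$ is the minimal nonnegative solution of $X=\sum_{i=-1}^\infty A_iX^{i+1}$ (it exists and $G\mathbf 1\le \mathbf 1$, $\mathbf 1$ the all-ones vector); "minimal" means entrywise less than or equal to every other nonnegative solution. For a family $\{A_{\ell,i}\}$, $A_\ell(z)=\sum_{i=0}^\infty A_{\ell,i}z^i$ and $A_\ell(G)=\sum_{i=0}^\infty A_{\ell,i}G^i$, with $G^0=I$. The constraints on the family are equivalent to $\sum_{\ell=-1}^qA_\ell(z)z^{\ell+1}=\sum_{i=-1}^\infty A_iz^{i+1}$. *)

theory Defs
  imports "HOL-Analysis.Analysis"
begin

text \<open>
  Square matrices are \<^typ>\<open>real ^ 'n ^ 'n\<close>. The library order \<open>\<le>\<close> on this type is entrywise.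
  Its class multiplication is entrywise too, so \<open>X ^ k\<close> is not the matrix power;
  powers with respect to the matrix product are defined here.
\<close>

primrec mat_power :: "real ^ 'n ^ 'n \<Rightarrow> nat \<Rightarrow> real ^ 'n ^ 'n" where
  "mat_power X 0 = mat 1"
| "mat_power X (Suc k) = X ** mat_power X k"

definition stochastic :: "real ^ 'n ^ 'n \<Rightarrow> bool" where
  "stochastic P \<longleftrightarrow> (\<forall>r c. 0 \<le> P $ r $ c) \<and> (\<forall>r. (\<Sum>c\<in>UNIV. P $ r $ c) = 1)"

text \<open>
  The sequence \<open>A\<close> is indexed by integers, only the indices \<open>i \<ge> -1\<close> being relevant. Sums over
  \<open>i \<ge> -1\<close> are reindexed by \<open>k = i + 1\<close>.
\<close>

definition nonneg_solution :: "(int \<Rightarrow> real ^ 'n ^ 'n) \<Rightarrow> real ^ 'n ^ 'n \<Rightarrow> bool" where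
  "nonneg_solution A X \<longleftrightarrow> 0 \<le> X \<and> (\<lambda>k. A (int k - 1) ** mat_power X k) sums X"

definition minimal_nonneg_solution :: "(int \<Rightarrow> real ^ 'n ^ 'n) \<Rightarrow> real ^ 'n ^ 'n \<Rightarrow> bool" where
  "minimal_nonneg_solution A G \<longleftrightarrow>
     nonneg_solution A G \<and> (\<forall>X. nonneg_solution A X \<longrightarrow> G \<le> X)"

text \<open>
  A family is a function \<open>B\<close> with \<open>B l i\<close> standing for \<open>A\<^sub>l\<^sub>,\<^sub>i\<close>; its values for \<open>l\<close> outside
  \<open>{-1..q}\<close> are irrelevant.
\<close>

definition admissible_family ::
    "nat \<Rightarrow> (int \<Rightarrow> real ^ 'n ^ 'n) \<Rightarrow> (int \<Rightarrow> nat \<Rightarrow> real ^ 'n ^ 'n) \<Rightarrow> bool" where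
  "admissible_family q A B \<longleftrightarrow>
     (\<forall>l\<in>{-1..int q}. \<forall>i. 0 \<le> B l i) \<and>
     (\<forall>\<nu>\<in>{-1..int q}. A \<nu> = (\<Sum>l=-1..\<nu>. B l (nat (\<nu> - l)))) \<and>
     (\<forall>\<nu>\<ge>int q + 1. A \<nu> = (\<Sum>l=-1..int q. B l (nat (\<nu> - l))))"

definition mat_series :: "(nat \<Rightarrow> real ^ 'n ^ 'n) \<Rightarrow> real ^ 'n ^ 'n \<Rightarrow> real ^ 'n ^ 'n" where
  "mat_series C X = (\<Sum>i. C i ** mat_power X i)"

definition F_matrix ::
    "nat \<Rightarrow> real ^ 'n ^ 'n \<Rightarrow> (int \<Rightarrow> nat \<Rightarrow> real ^ 'n ^ 'n) \<Rightarrow> real ^ 'n ^ 'n" where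
  "F_matrix q G B = (\<Sum>l=0..q. mat_series (B (int l)) G ** (\<Sum>j=0..l. mat_power G j))"

definition opt_family ::
    "nat \<Rightarrow> (int \<Rightarrow> real ^ 'n ^ 'n) \<Rightarrow> int \<Rightarrow> nat \<Rightarrow> real ^ 'n ^ 'n" where
  "opt_family q A l i =
     (if i = 0 then A l else if l = int q then A (int q + int i) else 0)"

text \<open>The generating function \<open>A\<^sub>l(z)\<close>, as a formal power series in \<open>z\<close> with matrix coefficients.\<close>

definition gen_fun :: "(int \<Rightarrow> nat \<Rightarrow> real ^ 'n ^ 'n) \<Rightarrow> int \<Rightarrow> (real ^ 'n ^ 'n) fps" where
  "gen_fun B l = Abs_fps (B l)"

end

theory Submission
  imports Defs
begin

text \<open>
  Expanding \<open>F\<close> and grouping the terms with \<open>l + i = \<nu>\<close> gives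
  \<open>\<Sum>\<^sub>l A\<^sub>l\<^sub>,\<^sub>\<nu>\<^sub>-\<^sub>l (G\<^bsup>\<nu>-l\<^esup> + \<dots> + G\<^bsup>\<nu>\<^esup>)\<close>. Since \<open>G \<ge> 0\<close>, the second factor grows with \<open>l\<close>,
  and the first factors sum to at most \<open>A\<^sub>\<nu>\<close>, so the best choice puts all of \<open>A\<^sub>\<nu>\<close> on the
  largest admissible index \<open>l = min \<nu> q\<close>.
  Convergence of all the series follows from \<open>G\<close> being substochastic. For that, Brouwer's theorem
  on the compact convex set of substochastic matrices yields some substochastic solution, which
  dominates the minimal one.
\<close>

section \<open>Matrix product, matrix powers and the entrywise order\<close>

lemma bounded_bilinear_matrix_mult:
  "bounded_bilinear ((**) :: real ^ 'n ^ 'm \<Rightarrow> real ^ 'p ^ 'n \<Rightarrow> real ^ 'p ^ 'm)"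
  unfolding bilinear_conv_bounded_bilinear[symmetric] bilinear_def
  by (auto intro!: linearI simp: vec_eq_iff matrix_matrix_mult_def sum.distrib algebra_simps
      sum_distrib_left)

interpretation matrix_mult: bounded_bilinear
  "(**) :: real ^ 'n ^ 'm \<Rightarrow> real ^ 'p ^ 'n \<Rightarrow> real ^ 'p ^ 'm"
  by (rule bounded_bilinear_matrix_mult)

lemma nonneg_matrix_iff: "0 \<le> (X :: real ^ 'n ^ 'm) \<longleftrightarrow> (\<forall>r c. 0 \<le> X $ r $ c)"
  by (simp add: less_eq_vec_def)

lemma matrix_mult_nonneg:
  fixes X :: "real ^ 'n ^ 'm" and Y :: "real ^ 'p ^ 'n"
  assumes "0 \<le> X" "0 \<le> Y"
  shows "0 \<le> X ** Y"
  using assms by (auto simp: nonneg_matrix_iff matrix_matrix_mult_def intro!: sum_nonneg)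

text \<open>The intermediate product is \<open>X' ** Y\<close>: enlarging the left factor uses
  \<open>0 \<le> Y\<close>, then enlarging the right one uses \<open>0 \<le> X'\<close>.\<close>

lemma matrix_mult_mono:
  fixes X X' :: "real ^ 'n ^ 'm" and Y Y' :: "real ^ 'p ^ 'n"
  assumes "X \<le> X'" "Y \<le> Y'" "0 \<le> X'" "0 \<le> Y"
  shows "X ** Y \<le> X' ** Y'"
  using assms
  by (auto simp: less_eq_vec_def matrix_matrix_mult_def intro!: sum_mono mult_mono)

lemma matrix_sums_le:
  fixes f g :: "nat \<Rightarrow> real ^ 'n ^ 'm"
  assumes "f sums x" "g sums y" "\<And>n. f n \<le> g n"
  shows "x \<le> y"
proof -
  have "x $ r $ c \<le> y $ r $ c" for r c
  proof (rule sums_le)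
    show "f n $ r $ c \<le> g n $ r $ c" for n
      using assms(3)[of n] by (simp add: less_eq_vec_def)
    show "(\<lambda>n. f n $ r $ c) sums (x $ r $ c)" "(\<lambda>n. g n $ r $ c) sums (y $ r $ c)"
      using assms(1,2) by (auto intro!: bounded_linear.sums[OF bounded_linear_vec_nth])
  qed
  then show ?thesis by (simp add: less_eq_vec_def)
qed

lemma mat_power_nonneg: "0 \<le> X \<Longrightarrow> 0 \<le> mat_power X k"
proof (induction k)
  case 0
  then show ?case by (simp add: nonneg_matrix_iff mat_def)
qed (simp add: matrix_mult_nonneg)

lemma mat_power_add: "mat_power X (i + j) = mat_power X i ** mat_power X j"
  by (induction i) (auto simp: matrix_mul_assoc)

lemma continuous_on_mat_power: "continuous_on S (\<lambda>X. mat_power X k)"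
  by (induction k) (auto intro!: matrix_mult.continuous_on continuous_intros)

section \<open>Substochastic matrices and norm bounds\<close>

definition substochastic :: "real ^ 'n ^ 'n \<Rightarrow> bool" where
  "substochastic X \<longleftrightarrow> 0 \<le> X \<and> (\<forall>r. (\<Sum>c\<in>UNIV. X $ r $ c) \<le> 1)"

lemma substochastic_nonneg: "substochastic X \<Longrightarrow> 0 \<le> X"
  by (simp add: substochastic_def)

lemma substochastic_antimono: "0 \<le> X \<Longrightarrow> X \<le> Y \<Longrightarrow> substochastic Y \<Longrightarrow> substochastic X"
  unfolding substochastic_def less_eq_vec_def by (meson order_trans sum_mono)

text \<open>Exchanging the two sums turns a row sum of the product into a combination of the row
  sums of \<open>X\<close> with weights from \<open>C\<close>.\<close>

lemma row_sum_mult_substochastic: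
  fixes C X :: "real ^ 'n ^ 'n"
  assumes "0 \<le> C" "substochastic X"
  shows "(\<Sum>c\<in>UNIV. (C ** X) $ r $ c) \<le> (\<Sum>c\<in>UNIV. C $ r $ c)"
proof -
  have "(\<Sum>c\<in>UNIV. (C ** X) $ r $ c) = (\<Sum>k\<in>UNIV. C $ r $ k * (\<Sum>c\<in>UNIV. X $ k $ c))"
    unfolding matrix_matrix_mult_def by (simp add: sum_distrib_left) (rule sum.swap)
  also have "\<dots> \<le> (\<Sum>k\<in>UNIV. C $ r $ k * 1)"
    using assms by (intro sum_mono mult_left_mono) (auto simp: substochastic_def nonneg_matrix_iff)
  finally show ?thesis by simp
qed

lemma substochastic_mat_power: "substochastic X \<Longrightarrow> substochastic (mat_power X k)"
proof (induction k)
  case 0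
  then show ?case by (simp add: substochastic_def nonneg_matrix_iff mat_def)
next
  case (Suc k)
  then show ?case
    using row_sum_mult_substochastic[of X "mat_power X k"]
    by (auto simp: substochastic_def intro: matrix_mult_nonneg order_trans)
qed

text \<open>The bound is independent of \<open>X\<close>, so it serves as a majorant both for
  summability and for uniform convergence. With \<open>X = mat 1\<close> it bounds
  \<open>norm C\<close> itself.\<close>

lemma norm_mult_substochastic_le:
  fixes C X :: "real ^ 'n ^ 'n"
  assumes "0 \<le> C" "substochastic X"
  shows "norm (C ** X) \<le> (\<Sum>r\<in>UNIV. \<Sum>c\<in>UNIV. C $ r $ c)"
proof -
  have 0: "0 \<le> C ** X"
    using assms by (intro matrix_mult_nonneg) (auto simp: substochastic_def)
  have "norm (C ** X) \<le> (\<Sum>r\<in>UNIV. norm ((C ** X) $ r))"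
    unfolding norm_vec_def by (rule L2_set_le_sum) simp
  also have "\<dots> \<le> (\<Sum>r\<in>UNIV. \<Sum>c\<in>UNIV. \<bar>(C ** X) $ r $ c\<bar>)"
    by (intro sum_mono norm_le_l1_cart)
  also have "\<dots> = (\<Sum>r\<in>UNIV. \<Sum>c\<in>UNIV. (C ** X) $ r $ c)"
    using 0 by (simp add: nonneg_matrix_iff)
  also have "\<dots> \<le> (\<Sum>r\<in>UNIV. \<Sum>c\<in>UNIV. C $ r $ c)"
    by (intro sum_mono row_sum_mult_substochastic assms)
  finally show ?thesis .
qed

lemma summable_entry_sum:
  fixes C :: "nat \<Rightarrow> real ^ 'n ^ 'm"
  assumes "summable C"
  shows "summable (\<lambda>k. \<Sum>r\<in>UNIV. \<Sum>c\<in>UNIV. C k $ r $ c)"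
  using assms
  by (auto intro!: summable_sum bounded_linear.summable[OF bounded_linear_vec_nth])

lemma summable_mult_mat_power:
  fixes C :: "nat \<Rightarrow> real ^ 'n ^ 'n"
  assumes "\<And>k. 0 \<le> C k" "summable C" "substochastic X"
  shows "summable (\<lambda>k. C k ** mat_power X k)"
  by (rule summable_comparison_test'[OF summable_entry_sum[OF assms(2)], where N=0])
    (intro norm_mult_substochastic_le substochastic_mat_power assms)

section \<open>A substochastic solution by Brouwer's theorem\<close>

lemma compact_substochastic: "compact {X :: real ^ 'n ^ 'n. substochastic X}"
proof -
  have "substochastic X \<Longrightarrow> norm X \<le> (\<Sum>r\<in>UNIV. \<Sum>c\<in>UNIV. (mat 1 :: real ^ 'n ^ 'n) $ r $ c)"
    for X :: "real ^ 'n ^ 'n"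
    \<comment> \<open>The instance of \<open>mat_power_nonneg\<close> only supplies
      \<open>0 \<le> mat 1\<close>, as the zeroth power of the zero matrix.\<close>
    using norm_mult_substochastic_le[of "mat 1" X] mat_power_nonneg[of "0 :: real ^ 'n ^ 'n" 0]
    by simp
  then have "bounded {X :: real ^ 'n ^ 'n. substochastic X}"
    unfolding bounded_iff by blast
  moreover have "closed {X :: real ^ 'n ^ 'n. substochastic X}"
    unfolding substochastic_def nonneg_matrix_iff
    by (intro closed_Collect_conj closed_Collect_all closed_Collect_le continuous_intros)
  ultimately show ?thesis by (simp add: compact_eq_bounded_closed)
qed

lemma convex_substochastic: "convex {X :: real ^ 'n ^ 'n. substochastic X}"
proof (rule convexI, clarify)
  fix X Y :: "real ^ 'n ^ 'n" and u v :: real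
  assume *: "substochastic X" "substochastic Y" "0 \<le> u" "0 \<le> v" "u + v = 1"
  have "(\<Sum>c\<in>UNIV. (u *\<^sub>R X + v *\<^sub>R Y) $ r $ c) \<le> 1" for r
  proof -
    have "(\<Sum>c\<in>UNIV. (u *\<^sub>R X + v *\<^sub>R Y) $ r $ c)
        = u * (\<Sum>c\<in>UNIV. X $ r $ c) + v * (\<Sum>c\<in>UNIV. Y $ r $ c)"
      by (simp add: sum.distrib sum_distrib_left)
    also have "\<dots> \<le> 1"
      using * by (intro convex_bound_le) (auto simp: substochastic_def)
    finally show ?thesis .
  qed
  then show "substochastic (u *\<^sub>R X + v *\<^sub>R Y)"
    using * by (auto simp: substochastic_def nonneg_matrix_iff)
qed

lemma substochastic_solution_exists:
  fixes A :: "int \<Rightarrow> real ^ 'n ^ 'n"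
  assumes nonneg: "\<And>i. -1 \<le> i \<Longrightarrow> 0 \<le> A i"
    and sum_A: "(\<lambda>k. A (int k - 1)) sums P"
    and P: "substochastic P"
  obtains X where "nonneg_solution A X" "substochastic X"
proof -
  let ?S = "{X :: real ^ 'n ^ 'n. substochastic X}"
  define \<Phi> where "\<Phi> X = (\<Sum>k. A (int k - 1) ** mat_power X k)" for X
  have sums: "(\<lambda>k. A (int k - 1) ** mat_power X k) sums \<Phi> X" if "substochastic X" for X
    unfolding \<Phi>_def using nonneg sum_A that
    by (intro summable_sums summable_mult_mat_power) (auto simp: sums_iff)
  have "continuous_on ?S \<Phi>"
  proof (rule uniform_limit_theorem)
    \<comment> \<open>Continuity of \<open>\<Phi>\<close> comes from uniform convergence of its
      partial sums, which are polynomials in \<open>X\<close>; the entry sums of the coefficients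
      are the majorant.\<close>
    show "uniform_limit ?S (\<lambda>n X. \<Sum>k<n. A (int k - 1) ** mat_power X k) \<Phi> sequentially"
      unfolding \<Phi>_def
    proof (rule Weierstrass_m_test)
      show "norm (A (int k - 1) ** mat_power X k)
          \<le> (\<Sum>r\<in>UNIV. \<Sum>c\<in>UNIV. A (int k - 1) $ r $ c)" if "X \<in> ?S" for k X
        using that nonneg by (intro norm_mult_substochastic_le substochastic_mat_power) auto
      show "summable (\<lambda>k. \<Sum>r\<in>UNIV. \<Sum>c\<in>UNIV. A (int k - 1) $ r $ c)"
        using sum_A by (intro summable_entry_sum) (auto simp: sums_iff)
    qed
  qed (auto intro!: always_eventually continuous_intros matrix_mult.continuous_on continuous_on_mat_power)
  moreover have "\<Phi> \<in> ?S \<rightarrow> ?S"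
  proof clarify
    fix X :: "real ^ 'n ^ 'n"
    assume X: "substochastic X"
    \<comment> \<open>Multiplying a coefficient by a power of \<open>X\<close> does not increase row
      sums, so the comparison with \<open>P\<close> is termwise.\<close>
    have "(\<Sum>c\<in>UNIV. \<Phi> X $ r $ c) \<le> (\<Sum>c\<in>UNIV. P $ r $ c)" for r
    proof (rule sums_le)
      show "(\<Sum>c\<in>UNIV. (A (int k - 1) ** mat_power X k) $ r $ c)
          \<le> (\<Sum>c\<in>UNIV. A (int k - 1) $ r $ c)" for k
        using X nonneg by (intro row_sum_mult_substochastic substochastic_mat_power) auto
      show "(\<lambda>k. \<Sum>c\<in>UNIV. (A (int k - 1) ** mat_power X k) $ r $ c)
          sums (\<Sum>c\<in>UNIV. \<Phi> X $ r $ c)"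
        using sums[OF X] by (intro sums_sum bounded_linear.sums[OF bounded_linear_vec_nth])
      show "(\<lambda>k. \<Sum>c\<in>UNIV. A (int k - 1) $ r $ c) sums (\<Sum>c\<in>UNIV. P $ r $ c)"
        using sum_A by (intro sums_sum bounded_linear.sums[OF bounded_linear_vec_nth])
    qed
    moreover have "0 \<le> \<Phi> X"
      using X nonneg
      by (intro matrix_sums_le[OF sums_zero sums[OF X]] matrix_mult_nonneg mat_power_nonneg)
        (auto dest: substochastic_nonneg)
    ultimately show "substochastic (\<Phi> X)"
      using P unfolding substochastic_def by (meson order_trans)
  qed
  moreover have "?S \<noteq> {}"
    using P by blast
  ultimately obtain X where "X \<in> ?S" "\<Phi> X = X"
    using brouwer[OF compact_substochastic convex_substochastic] by blast
  with sums[of X] that show thesis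
    by (auto simp: nonneg_solution_def dest: substochastic_nonneg)
qed

section \<open>Admissible families and the series for \<open>F\<close>\<close>

lemma admissible_family_nonneg:
  "admissible_family q A B \<Longrightarrow> -1 \<le> l \<Longrightarrow> l \<le> int q \<Longrightarrow> 0 \<le> B l i"
  by (simp add: admissible_family_def)

text \<open>The upper limit \<open>min \<nu> q\<close> merges the two kinds of constraint for
  \<open>\<nu> \<ge> 0\<close>.\<close>

lemma admissible_family_eq:
  assumes "admissible_family q A B"
  shows "A (int \<nu>) = (\<Sum>l=-1..int (min \<nu> q). B l (nat (int \<nu> - l)))"
proof (cases "\<nu> \<le> q")
  case True
  then show ?thesis using assms by (simp add: admissible_family_def)
next
  case False
  then show ?thesis using assms by (simp add: admissible_family_def)
qed

text \<open>The gap is the nonnegative summand with \<open>l = -1\<close>, which contributes to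
  \<open>A \<nu>\<close> but not to \<open>F\<close>.\<close>

lemma admissible_family_sum_le:
  fixes B :: "int \<Rightarrow> nat \<Rightarrow> real ^ 'n ^ 'n"
  assumes "admissible_family q A B"
  shows "(\<Sum>l=0..min \<nu> q. B (int l) (\<nu> - l)) \<le> A (int \<nu>)"
proof -
  have "(\<Sum>l=0..min \<nu> q. B (int l) (\<nu> - l))
      = (\<Sum>l\<in>int ` {0..min \<nu> q}. B l (nat (int \<nu> - l)))"
    by (subst sum.reindex) (auto simp: nat_diff_distrib intro!: sum.cong)
  also have "\<dots> \<le> (\<Sum>l=-1..int (min \<nu> q). B l (nat (int \<nu> - l)))"
    by (intro sum_mono2 admissible_family_nonneg[OF assms]) auto
  finally show ?thesis by (simp only: admissible_family_eq[OF assms])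
qed

text \<open>One summand of a nonnegative sum is at most the whole; this makes a shift of
  \<open>A\<close> a majorant for each sequence \<open>B l\<close>.\<close>

lemma admissible_family_le:
  fixes B :: "int \<Rightarrow> nat \<Rightarrow> real ^ 'n ^ 'n"
  assumes "admissible_family q A B" "l \<le> q"
  shows "B (int l) i \<le> A (int (l + i))"
proof -
  have "B (int l) (l + i - l) \<le> (\<Sum>k=0..min (l + i) q. B (int k) (l + i - k))"
    by (rule member_le_sum[of l _ "\<lambda>k. B (int k) (l + i - k)"])
       (use assms admissible_family_nonneg[OF assms(1)] in auto)
  with admissible_family_sum_le[OF assms(1), of "l + i"] show ?thesis by simp
qed

text \<open>Only finitely many series occur, one for each \<open>l \<le> q\<close>. Shifting each by
  \<open>l\<close> places and adding termwise groups by \<open>\<nu> = l + i\<close> without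
  rearranging a double series.\<close>

lemma F_matrix_sums:
  fixes A :: "int \<Rightarrow> real ^ 'n ^ 'n"
  assumes B: "admissible_family q A B"
    and A: "summable (\<lambda>k. A (int k - 1))"
    and G: "substochastic G"
  shows "(\<lambda>\<nu>. \<Sum>l=0..min \<nu> q. B (int l) (\<nu> - l) ** (\<Sum>j=\<nu>-l..\<nu>. mat_power G j))
    sums F_matrix q G B"
proof -
  define S where "S l = (\<Sum>j=0..l. mat_power G j)" for l
  have *: "(\<lambda>\<nu>. if \<nu> < l then 0 else B (int l) (\<nu> - l) ** mat_power G (\<nu> - l) ** S l)
      sums (mat_series (B (int l)) G ** S l)" if l: "l \<le> q" for l
  proof -
    have B0: "0 \<le> B (int l) i" for i
      using B l by (intro admissible_family_nonneg) auto
    \<comment> \<open>The shift is \<open>l + 1\<close> because the series of \<open>A\<close>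
      starts at index \<open>-1\<close>.\<close>
    have "summable (\<lambda>k. A (int (k + (l + 1)) - 1))"
      using A by (subst summable_iff_shift)
    then have A': "summable (\<lambda>i. A (int (l + i)))"
      by (simp add: add.commute)
    have "summable (\<lambda>i. B (int l) i)"
    proof (rule summable_comparison_test'[OF summable_entry_sum[OF A'], where N=0])
      fix i
      have "norm (B (int l) i) \<le> (\<Sum>r\<in>UNIV. \<Sum>c\<in>UNIV. B (int l) i $ r $ c)"
        using norm_mult_substochastic_le[OF B0, of "mat 1"]
          substochastic_mat_power[OF G, of 0] by simp
      also have "\<dots> \<le> (\<Sum>r\<in>UNIV. \<Sum>c\<in>UNIV. A (int (l + i)) $ r $ c)"
        using admissible_family_le[OF B l, of i] by (intro sum_mono) (simp add: less_eq_vec_def)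
      finally show "norm (B (int l) i) \<le> (\<Sum>r\<in>UNIV. \<Sum>c\<in>UNIV. A (int (l + i)) $ r $ c)" .
    qed
    then have "(\<lambda>i. B (int l) i ** mat_power G i) sums mat_series (B (int l)) G"
      unfolding mat_series_def by (intro summable_sums summable_mult_mat_power B0 G)
    from bounded_linear.sums[OF matrix_mult.bounded_linear_left this, of "S l"]
    show ?thesis
      \<comment> \<open>The first \<open>l\<close> terms are zero padding, so the sum is
        unchanged.\<close>
      by (subst sums_zero_iff_shift[of l, symmetric]) auto
  qed
  have "(\<lambda>\<nu>. \<Sum>l=0..q. if \<nu> < l then 0 else B (int l) (\<nu> - l) ** mat_power G (\<nu> - l) ** S l)
      sums (\<Sum>l=0..q. mat_series (B (int l)) G ** S l)"
    by (intro sums_sum *) auto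
  moreover have "(\<Sum>l=0..q. if \<nu> < l then 0 else B (int l) (\<nu> - l) ** mat_power G (\<nu> - l) ** S l)
      = (\<Sum>l=0..min \<nu> q. B (int l) (\<nu> - l) ** (\<Sum>j=\<nu>-l..\<nu>. mat_power G j))" for \<nu>
  proof -
    have "mat_power G (\<nu> - l) ** S l = (\<Sum>j=\<nu>-l..\<nu>. mat_power G j)" if "l \<le> \<nu>" for l
    proof -
      have "mat_power G (\<nu> - l) ** S l = (\<Sum>j=0..l. mat_power G (j + (\<nu> - l)))"
        by (simp add: S_def matrix_mult.sum_right mat_power_add[symmetric] add.commute)
      also have "\<dots> = (\<Sum>j=0+(\<nu>-l)..l+(\<nu>-l). mat_power G j)"
        by (rule sum.shift_bounds_cl_nat_ivl[symmetric])
      finally show ?thesis using that by simp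
    qed
    then show ?thesis
      by (intro sum.mono_neutral_cong_right) (auto simp: matrix_mul_assoc[symmetric])
  qed
  ultimately show ?thesis
    by (simp add: F_matrix_def S_def)
qed

text \<open>Each constraint sum has a single possibly nonzero term, at \<open>l = \<nu>\<close> or
  at \<open>l = q\<close> respectively.\<close>

lemma admissible_opt_family:
  assumes nonneg: "\<And>i. -1 \<le> i \<Longrightarrow> 0 \<le> A i"
  shows "admissible_family q A (opt_family q A)"
  unfolding admissible_family_def
proof (intro conjI ballI allI impI)
  fix l i assume "l \<in> {-1..int q}"
  then show "0 \<le> opt_family q A l i"
    using nonneg by (auto simp: opt_family_def)
next
  fix \<nu> assume \<nu>: "\<nu> \<in> {-1..int q}"
  have "(\<Sum>l=-1..\<nu>. opt_family q A l (nat (\<nu> - l))) = (\<Sum>l\<in>{\<nu>}. A l)"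
    using \<nu> by (intro sum.mono_neutral_cong_right) (auto simp: opt_family_def)
  then show "A \<nu> = (\<Sum>l=-1..\<nu>. opt_family q A l (nat (\<nu> - l)))" by simp
next
  fix \<nu> assume \<nu>: "int q + 1 \<le> \<nu>"
  have "(\<Sum>l=-1..int q. opt_family q A l (nat (\<nu> - l))) = (\<Sum>l\<in>{int q}. A \<nu>)"
    using \<nu> by (intro sum.mono_neutral_cong_right) (auto simp: opt_family_def)
  then show "A \<nu> = (\<Sum>l=-1..int q. opt_family q A l (nat (\<nu> - l)))" by simp
qed

lemma opt_family_antidiagonal:
  assumes "l \<le> min \<nu> q"
  shows "opt_family q A (int l) (\<nu> - l) = (if l = min \<nu> q then A (int \<nu>) else 0)"
  using assms by (auto simp: opt_family_def min_def of_nat_diff)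

theorem theorem11:
  fixes A :: "int \<Rightarrow> real ^ 'n ^ 'n" and P G :: "real ^ 'n ^ 'n" and q :: nat
  assumes q: "1 \<le> q"
    and nonneg: "\<And>i. -1 \<le> i \<Longrightarrow> 0 \<le> A i"
    and sum_A: "(\<lambda>k. A (int k - 1)) sums P"
    and stoch: "stochastic P"
    and G: "minimal_nonneg_solution A G"
  shows "admissible_family q A (opt_family q A)
    \<and> (\<forall>B. admissible_family q A B \<longrightarrow> F_matrix q G B \<le> F_matrix q G (opt_family q A))
    \<and> (\<forall>l\<in>{-1..int q - 1}. gen_fun (opt_family q A) l = fps_const (A l))
    \<and> gen_fun (opt_family q A) (int q) = Abs_fps (\<lambda>k. A (int q + int k))"
proof (intro conjI allI impI ballI)
  show opt: "admissible_family q A (opt_family q A)"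
    by (rule admissible_opt_family[OF nonneg])
  have "substochastic P"
    using stoch by (simp add: stochastic_def substochastic_def nonneg_matrix_iff)
  then obtain X where "nonneg_solution A X" "substochastic X"
    using substochastic_solution_exists[OF nonneg sum_A] by blast
  \<comment> \<open>Minimality gives \<open>G \<le> X\<close>, and \<open>X\<close> is
    substochastic.\<close>
  with G have G': "substochastic G"
    by (auto simp: minimal_nonneg_solution_def nonneg_solution_def intro: substochastic_antimono)
  have A: "summable (\<lambda>k. A (int k - 1))"
    using sum_A by (rule sums_summable)
  fix B assume B: "admissible_family q A B"
  show "F_matrix q G B \<le> F_matrix q G (opt_family q A)"
  proof (rule matrix_sums_le[OF F_matrix_sums[OF B A G'] F_matrix_sums[OF opt A G']])
    fix \<nu>
    define W where "W l = (\<Sum>j=\<nu>-l..\<nu>. mat_power G j)" for l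
    let ?m = "min \<nu> q"
    have pow: "0 \<le> mat_power G j" for j
      using G' by (intro mat_power_nonneg substochastic_nonneg)
    have W: "0 \<le> W l" for l
      unfolding W_def by (intro sum_nonneg pow)
    have "(\<Sum>l=0..?m. B (int l) (\<nu> - l) ** W l) \<le> (\<Sum>l=0..?m. B (int l) (\<nu> - l) ** W ?m)"
    proof (intro sum_mono matrix_mult_mono order_refl W)
      fix l assume l: "l \<in> {0..?m}"
      \<comment> \<open>The exponent range from \<open>\<nu> - l\<close> to \<open>\<nu>\<close>
        widens as \<open>l\<close> grows, and the added powers are nonnegative.\<close>
      then show "W l \<le> W ?m"
        unfolding W_def by (intro sum_mono2 pow) auto
      show "0 \<le> B (int l) (\<nu> - l)"
        using l by (intro admissible_family_nonneg[OF B]) auto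
    qed
    also have "\<dots> = (\<Sum>l=0..?m. B (int l) (\<nu> - l)) ** W ?m"
      by (simp add: matrix_mult.sum_left)
    also have "\<dots> \<le> A (int \<nu>) ** W ?m"
      using nonneg by (intro matrix_mult_mono admissible_family_sum_le[OF B] W) auto
    \<comment> \<open>The singleton sum can be padded with the zero terms of
      \<open>opt_family\<close> to the full range.\<close>
    also have "\<dots> = (\<Sum>l\<in>{?m}. A (int \<nu>) ** W l)"
      by simp
    also have "\<dots> = (\<Sum>l=0..?m. opt_family q A (int l) (\<nu> - l) ** W l)"
      by (intro sum.mono_neutral_cong_left) (auto simp: opt_family_antidiagonal)
    finally show "(\<Sum>l=0..?m. B (int l) (\<nu> - l) ** (\<Sum>j=\<nu>-l..\<nu>. mat_power G j))
        \<le> (\<Sum>l=0..?m. opt_family q A (int l) (\<nu> - l) ** (\<Sum>j=\<nu>-l..\<nu>. mat_power G j))"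
      unfolding W_def .
  qed
next
  fix l assume "l \<in> {-1..int q - 1}"
  then show "gen_fun (opt_family q A) l = fps_const (A l)"
    by (auto simp: gen_fun_def opt_family_def fps_eq_iff)
next
  show "gen_fun (opt_family q A) (int q) = Abs_fps (\<lambda>k. A (int q + int k))"
    by (auto simp: gen_fun_def opt_family_def fps_eq_iff)
qed

end
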